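(* Let $m\neq 0$ be a scalar. (i) Let $M=m\cdot 1,\,K,\,G,\,D,\,P_x,\,P_t$ be operators giving a representation of the Schrödinger algebra $\mathcal S_1$ in which $M$ acts as the scalar $m$. Then there exist elements $L_0,R_0,\rho_0$ of the associative algebra generated by these operators (and the identity) that satisfy the standard $sl(2)$ relations, such that $$K=R_0+\frac{1}{2m}G^2,\qquad D=\rho_0+\frac1m\,GP_x+\frac12,\qquad P_t=L_0+\frac1{2m}P_x^2,$$ and each of $L_0,R_0,\rho_0$ commutes with $P_x$ and with $G$. (ii) Conversely, let $P_x,G$ be operators on a vector space with $[P_x,G]=m\cdot 1$ (an $m$-HW representation), and let $L_0,R_0,\rho_0$ be operators on the same space satisfying the standard $sl(2)$ relations, each commuting with $P_x$ and $G$. Then $$M=m\cdot 1,\quad G,\quad P_x,\quad K=R_0+\frac{1}{2m}G^2,\quad D=\rho_0+\frac1m\,GP_x+\frac12,\quad P_t=L_0+\frac1{2m}P_x^2$$ define a representation of $\mathcal S_1$.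
   Context: The ($n=1$, centrally extended) Schrödinger algebra $\mathcal S_1$ is the Lie algebra with basis $M,K,G,D,P_x,P_t$ and brackets $[P_t,K]=D$, $[P_t,G]=P_x$, $[P_t,D]=2P_t$, $[P_x,K]=G$, $[P_x,G]=M$, $[P_x,D]=P_x$, $[D,K]=2K$, $[D,G]=G$, $[K,G]=0$, $[P_x,P_t]=0$, $M$ central. The standard $sl(2)$ relations for $L,R,\rho$ are $[L,R]=\rho$, $[\rho,R]=2R$, $[L,\rho]=2L$. An $m$-HW algebra is a representation of the Heisenberg-Weyl algebra $[P,X]=H$, $[P,H]=[X,H]=0$ in which $H$ acts as $m$ times the identity. All brackets are commutators of operators. *)

theory Defs
  imports "HOL-Analysis.Cartesian_Space"
begin

datatype sch_basis = SM | SK | SG | SD | SPx | SPt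

lemma UNIV_sch_basis: "(UNIV :: sch_basis set) = {SM, SK, SG, SD, SPx, SPt}"
proof -
  have "x \<in> {SM, SK, SG, SD, SPx, SPt}" for x :: sch_basis
    by (cases x) simp_all
  then show ?thesis by blast
qed

instance sch_basis :: finite
  by standard (simp add: UNIV_sch_basis)

text \<open>
  The Schroedinger algebra is modelled on the coordinate space \<^typ>\<open>'k ^ sch_basis\<close>.
\<close>

abbreviation sch_e :: "sch_basis \<Rightarrow> ('k::field) ^ sch_basis" where
  "sch_e b \<equiv> axis b 1"

text \<open>
  Each pair of basis elements with a nonzero bracket occurs in exactly one of the two orders
  here; the bracket below antisymmetrises.
\<close>

fun sch_table :: "sch_basis \<Rightarrow> sch_basis \<Rightarrow> ('k::field) ^ sch_basis" where
  "sch_table SPt SK = sch_e SD"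
| "sch_table SPt SG = sch_e SPx"
| "sch_table SPt SD = 2 *s sch_e SPt"
| "sch_table SPx SK = sch_e SG"
| "sch_table SPx SG = sch_e SM"
| "sch_table SPx SD = sch_e SPx"
| "sch_table SD SK = 2 *s sch_e SK"
| "sch_table SD SG = sch_e SG"
| "sch_table _ _ = 0"

definition sch_bracket :: "('k::field) ^ sch_basis \<Rightarrow> 'k ^ sch_basis \<Rightarrow> 'k ^ sch_basis" where
  "sch_bracket x y =
     (\<Sum>a\<in>UNIV. \<Sum>b\<in>UNIV. (x $ a * y $ b) *s (sch_table a b - sch_table b a))"

lemma sch_bracket_basis: "sch_bracket (sch_e a) (sch_e b) = sch_table a b - sch_table b a"
proof -
  have "sch_bracket (sch_e a) (sch_e b) =
      (\<Sum>a'\<in>UNIV. if a' = a then (\<Sum>b'\<in>UNIV. if b' = b then sch_table a' b' - sch_table b' a' else 0) else 0)"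
    unfolding sch_bracket_def
    by (intro sum.cong refl) (simp add: axis_def if_distrib[of "\<lambda>c. c *s _"] cong: if_cong)
  then show ?thesis by simp
qed

lemma sch_bracket_alternating: "sch_bracket x x = 0"
  by (simp add: sch_bracket_def UNIV_sch_basis vec_eq_iff algebra_simps)

lemma sch_bracket_nth:
  "sch_bracket x y $ SM = x$SPx * y$SG - x$SG * y$SPx"
  "sch_bracket x y $ SK = 2 * (x$SD * y$SK - x$SK * y$SD)"
  "sch_bracket x y $ SG = x$SPx * y$SK - x$SK * y$SPx + (x$SD * y$SG - x$SG * y$SD)"
  "sch_bracket x y $ SD = x$SPt * y$SK - x$SK * y$SPt"
  "sch_bracket x y $ SPx = x$SPt * y$SG - x$SG * y$SPt + (x$SPx * y$SD - x$SD * y$SPx)"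
  "sch_bracket x y $ SPt = 2 * (x$SPt * y$SD - x$SD * y$SPt)"
  by (simp_all add: sch_bracket_def UNIV_sch_basis axis_def algebra_simps)

lemma sch_bracket_jacobi:
  "sch_bracket x (sch_bracket y z) + sch_bracket y (sch_bracket z x)
     + sch_bracket z (sch_bracket x y) = 0"
proof -
  have "(sch_bracket x (sch_bracket y z) + sch_bracket y (sch_bracket z x)
     + sch_bracket z (sch_bracket x y)) $ b = 0" for b
    by (cases b) (simp_all add: sch_bracket_nth algebra_simps)
  then show ?thesis by (simp add: vec_eq_iff)
qed

definition op_comm :: "('v::ab_group_add \<Rightarrow> 'v) \<Rightarrow> ('v \<Rightarrow> 'v) \<Rightarrow> 'v \<Rightarrow> 'v" where
  "op_comm A B = (\<lambda>v. A (B v) - B (A v))"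

text \<open>
  A Lie algebra representation on the vector space \<^typ>\<open>'v\<close> with scalar multiplication
  \<open>smul\<close>: the first two conditions say that \<open>\<phi>\<close> is a linear map into the linear
  endomorphisms of \<^typ>\<open>'v\<close>.
\<close>

definition sch_rep ::
    "('k::field \<Rightarrow> 'v::ab_group_add \<Rightarrow> 'v) \<Rightarrow> ('k ^ sch_basis \<Rightarrow> 'v \<Rightarrow> 'v) \<Rightarrow> bool" where
  "sch_rep smul \<phi> \<longleftrightarrow>
     (\<forall>x. Vector_Spaces.linear smul smul (\<phi> x)) \<and>
     (\<forall>v. Vector_Spaces.linear (*s) smul (\<lambda>x. \<phi> x v)) \<and>
     (\<forall>x y. \<phi> (sch_bracket x y) = op_comm (\<phi> x) (\<phi> y))"

definition sl2_relations ::
    "('k::field \<Rightarrow> 'v::ab_group_add \<Rightarrow> 'v) \<Rightarrow> ('v \<Rightarrow> 'v) \<Rightarrow> ('v \<Rightarrow> 'v) \<Rightarrow> ('v \<Rightarrow> 'v) \<Rightarrow> bool" where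
  "sl2_relations smul L R \<rho> \<longleftrightarrow>
     op_comm L R = \<rho> \<and>
     op_comm \<rho> R = (\<lambda>v. smul 2 (R v)) \<and>
     op_comm L \<rho> = (\<lambda>v. smul 2 (L v))"

inductive_set generated_algebra ::
    "('k::field \<Rightarrow> 'v::ab_group_add \<Rightarrow> 'v) \<Rightarrow> ('v \<Rightarrow> 'v) set \<Rightarrow> ('v \<Rightarrow> 'v) set"
  for smul S where
  gen: "A \<in> S \<Longrightarrow> A \<in> generated_algebra smul S"
| one: "id \<in> generated_algebra smul S"
| add: "A \<in> generated_algebra smul S \<Longrightarrow> B \<in> generated_algebra smul S \<Longrightarrow>
    (\<lambda>v. A v + B v) \<in> generated_algebra smul S"
| smul: "A \<in> generated_algebra smul S \<Longrightarrow> (\<lambda>v. smul c (A v)) \<in> generated_algebra smul S"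
| mult: "A \<in> generated_algebra smul S \<Longrightarrow> B \<in> generated_algebra smul S \<Longrightarrow>
    A \<circ> B \<in> generated_algebra smul S"

end

theory Submission
  imports Defs
begin

text \<open>
  Since \<open>G P\<^sub>x / m + 1/2 = (G P\<^sub>x + P\<^sub>x G) / (2 m)\<close>, the three correction terms are the
  oscillator representation of \<open>sl(2)\<close> built from the Heisenberg-Weyl pair, and they act on
  \<open>P\<^sub>x\<close> and \<open>G\<close> exactly as \<open>K\<close>, \<open>D\<close>, \<open>P\<^sub>t\<close> do.  Subtracting or adding them therefore passes between
  \<open>S\<^sub>1\<close> and \<open>sl(2)\<close> commuting with Heisenberg-Weyl.  All identities are checked by moving operators
  into a fixed order (a PBW normal form).
\<close>

section \<open>Representations through their values on the basis\<close>

lemma op_comm_eqD: "op_comm A B = C \<Longrightarrow> A (B v) = B (A v) + C v"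
  by (auto simp: op_comm_def)

text \<open>The linear extension of an assignment of operators to basis elements; by linearity it is
  the only candidate for a representation with these values.\<close>

definition sch_ext ::
    "('k::field \<Rightarrow> 'v::ab_group_add \<Rightarrow> 'v) \<Rightarrow> (sch_basis \<Rightarrow> 'v \<Rightarrow> 'v) \<Rightarrow> 'k ^ sch_basis \<Rightarrow> 'v \<Rightarrow> 'v" where
  "sch_ext smul T x v = (\<Sum>b\<in>UNIV. smul (x $ b) (T b v))"

context vector_space
begin

lemma sch_ext_axis: "sch_ext scale T (sch_e b) = T b"
proof
  fix v
  have "sch_ext scale T (sch_e b) v = (\<Sum>a\<in>UNIV. if a = b then T a v else 0)"
    unfolding sch_ext_def by (intro sum.cong) (auto simp: axis_def)
  then show "sch_ext scale T (sch_e b) v = T b v" by simp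
qed

lemma linear_sch_ext: "Vector_Spaces.linear vector_scalar_mult scale (\<lambda>x. sch_ext scale T x v)"
  by (simp add: linear_iff_module_hom module_hom_iff sch_ext_def scale_left_distrib
      sum.distrib scale_sum_right vec.module_axioms module_axioms mult.commute)

text \<open>Both sides of the bracket condition are bilinear in the two algebra elements, so the 36
  commutators of basis operators decide it.\<close>

lemma sch_rep_sch_ext:
  assumes lin: "\<And>b. Vector_Spaces.linear scale scale (T b)"
    and comm: "\<And>a b. op_comm (T a) (T b) = sch_ext scale T (sch_table a b - sch_table b a)"
  shows "sch_rep scale (sch_ext scale T)"
proof -
  have T_sum: "T b (sum f A) = (\<Sum>a\<in>A. T b (f a))" for b f and A :: "sch_basis set"
    using module_hom.sum[OF lin[unfolded linear_iff_module_hom]] .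
  have T_scale: "T b (scale c v) = scale c (T b v)" for b c v
    using lin[of b] by (simp add: linear_iff_module_hom module_hom_iff)
  have T_add: "T b (v + w) = T b v + T b w" for b v w
    using lin[of b] by (simp add: linear_iff_module_hom module_hom_iff)
  have prod: "sch_ext scale T x (sch_ext scale T y v)
      = (\<Sum>a\<in>UNIV. \<Sum>b\<in>UNIV. scale (x $ a * y $ b) (T a (T b v)))" for x y v
    by (simp add: sch_ext_def T_sum T_scale scale_sum_right)
  have "sch_ext scale T (sch_bracket x y) v = op_comm (sch_ext scale T x) (sch_ext scale T y) v"
    for x y v
  proof -
    interpret ext: Vector_Spaces.linear vector_scalar_mult scale "\<lambda>x. sch_ext scale T x v"
      by (rule linear_sch_ext)
    have "sch_ext scale T (sch_bracket x y) v
        = (\<Sum>a\<in>UNIV. \<Sum>b\<in>UNIV. scale (x $ a * y $ b) (op_comm (T a) (T b) v))"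
      by (simp add: sch_bracket_def comm ext.sum ext.scale)
    also have "\<dots> = (\<Sum>a\<in>UNIV. \<Sum>b\<in>UNIV. scale (x $ a * y $ b) (T a (T b v)))
        - (\<Sum>a\<in>UNIV. \<Sum>b\<in>UNIV. scale (x $ a * y $ b) (T b (T a v)))"
      by (simp add: op_comm_def scale_right_diff_distrib sum_subtractf)
    also have "(\<Sum>a\<in>UNIV. \<Sum>b\<in>UNIV. scale (x $ a * y $ b) (T b (T a v)))
        = sch_ext scale T y (sch_ext scale T x v)"
      \<comment> \<open>Exchanging the two summations turns the product \<open>T b (T a v)\<close>
        into the expansion with \<open>y\<close> acting after \<open>x\<close>.\<close>
      unfolding prod by (subst sum.swap) (simp add: mult.commute)
    finally show ?thesis
      by (simp add: op_comm_def prod)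
  qed
  moreover have "Vector_Spaces.linear scale scale (sch_ext scale T x)" for x
    by (simp add: linear_iff_module_hom module_hom_iff module_axioms sch_ext_def T_add T_scale
        scale_right_distrib sum.distrib scale_sum_right mult.commute)
  ultimately show ?thesis
    by (auto simp: sch_rep_def linear_sch_ext)
qed

text \<open>Expand \<open>x\<close> in the basis and use linearity in \<open>x\<close>. This yields
  the uniqueness of the representation in the converse direction.\<close>

lemma sch_rep_eq_sch_ext:
  assumes "sch_rep scale \<phi>"
  shows "\<phi> = sch_ext scale (\<lambda>b. \<phi> (sch_e b))"
proof (intro ext)
  fix x v
  interpret phi: Vector_Spaces.linear vector_scalar_mult scale "\<lambda>x. \<phi> x v"
    using assms by (simp add: sch_rep_def)
  have "\<phi> x v = \<phi> (\<Sum>b\<in>UNIV. vector_scalar_mult (x $ b) (sch_e b)) v"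
    by (simp add: basis_expansion)
  then show "\<phi> x v = sch_ext scale (\<lambda>b. \<phi> (sch_e b)) x v"
    by (simp add: sch_ext_def phi.sum phi.scale)
qed

text \<open>Phrased with \<open>sch_ext\<close> so that, for concrete \<open>a\<close> and
  \<open>b\<close>, \<open>sch_ext_simps\<close> and \<open>sch_ext_axis\<close> evaluate the table
  entry to an explicit combination of the operators.\<close>

lemma sch_rep_comm:
  assumes "sch_rep scale \<phi>"
  shows "op_comm (\<phi> (sch_e a)) (\<phi> (sch_e b)) v
    = sch_ext scale (\<lambda>b. \<phi> (sch_e b)) (sch_table a b - sch_table b a) v"
  using assms
  by (metis sch_bracket_basis sch_rep_def sch_rep_eq_sch_ext[OF assms])

lemma sch_ext_simps:
  "sch_ext scale T 0 v = 0"
  "sch_ext scale T (x - y) v = sch_ext scale T x v - sch_ext scale T y v"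
  "sch_ext scale T (- x) v = - sch_ext scale T x v"
  "sch_ext scale T (vector_scalar_mult c x) v = scale c (sch_ext scale T x v)"
proof -
  interpret ext: Vector_Spaces.linear vector_scalar_mult scale "\<lambda>x. sch_ext scale T x v"
    by (rule linear_sch_ext)
  show "sch_ext scale T 0 v = 0"
    "sch_ext scale T (x - y) v = sch_ext scale T x v - sch_ext scale T y v"
    "sch_ext scale T (- x) v = - sch_ext scale T x v"
    "sch_ext scale T (vector_scalar_mult c x) v = scale c (sch_ext scale T x v)"
    by (fact ext.zero ext.diff ext.neg ext.scale)+
qed

lemma scale_two: "scale 2 v = v + v"
  by (metis one_add_one scale_left_distrib scale_one)

end

section \<open>Normal ordering over a Heisenberg-Weyl pair\<close>

text \<open>
  With \<open>c = 1 / (2 m)\<close> all coefficients are integer polynomials in \<open>c\<close> and \<open>m\<close>; the rules below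
  keep them as nested scalings so that equal summands become adjacent under AC rewriting.
\<close>

locale half_inverse = vector_space scale
  for scale :: "'k::field \<Rightarrow> 'v::ab_group_add \<Rightarrow> 'v" +
  fixes c m :: 'k
  assumes half_inverse: "c * m + c * m = 1"
begin

text \<open>The relation \<open>2 c m = 1\<close> as a rewrite rule for nested scalings. The second
  form catches the equal pair when further summands follow it in a right-nested sum.\<close>

lemma scale_cm_double:
  "scale m (scale c v) + scale m (scale c v) = v"
  "scale m (scale c v) + (scale m (scale c v) + w) = v + w"
proof -
  show *: "scale m (scale c v) + scale m (scale c v) = v" for v
    by (metis half_inverse mult.commute scale_left_distrib scale_one scale_scale)
  show "scale m (scale c v) + (scale m (scale c v) + w) = v + w"
    by (simp only: * flip: add.assoc)
qed

text \<open>Puts \<open>m\<close> outside \<open>c\<close>, the form that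
  \<open>scale_cm_double\<close> matches.\<close>

lemma scale_cm: "scale c (scale m v) = scale m (scale c v)"
  by (rule scale_left_commute)

lemmas normalize = algebra_simps scale_two scale_cm scale_cm_double
  scale_right_distrib scale_right_diff_distrib scale_minus_right

lemma linear_simps:
  assumes "Vector_Spaces.linear scale scale A"
  shows "A (v + w) = A v + A w" "A (v - w) = A v - A w" "A (- v) = - A v"
    "A (scale a v) = scale a (A v)" "A 0 = 0"
proof -
  interpret A: Vector_Spaces.linear scale scale A by fact
  show "A (v + w) = A v + A w" "A (v - w) = A v - A w" "A (- v) = - A v"
    "A (scale a v) = scale a (A v)" "A 0 = 0"
    by (fact A.add A.diff A.neg A.scale A.zero)+
qed

text \<open>The subtracted quadratic terms have the same brackets with \<open>P\<close> and
  \<open>G\<close> as \<open>Q\<close>, \<open>K\<close>, \<open>D\<close>, so the differences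
  commute with \<open>P\<close> and \<open>G\<close>. Mixed brackets then vanish, and for instance
  [L, R] = [Q, K] - c^2 [P^2, G^2] = D - c (G P + P G), because [P^2, G^2] = 2 m (G P + P G) and 2 c
  m = 1.\<close>

lemma sch_rep_decomposition:
  assumes rep: "sch_rep scale \<phi>" and M: "\<phi> (sch_e SM) = scale m"
    and [simp]: "K = \<phi> (sch_e SK)" "G = \<phi> (sch_e SG)" "D = \<phi> (sch_e SD)"
      "P = \<phi> (sch_e SPx)" "Q = \<phi> (sch_e SPt)"
    and L_def: "L = (\<lambda>v. Q v - scale c (P (P v)))"
    and R_def: "R = (\<lambda>v. K v - scale c (G (G v)))"
    and \<rho>_def: "\<rho> = (\<lambda>v. D v - scale c (G (P v)) - scale c (P (G v)))"
  shows "sl2_relations scale L R \<rho>"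
    and "\<forall>A\<in>{L, R, \<rho>}. op_comm A P = (\<lambda>v. 0) \<and> op_comm A G = (\<lambda>v. 0)"
proof -
  have lin: "Vector_Spaces.linear scale scale (\<phi> x)" for x
    using rep by (simp add: sch_rep_def)
  note lin_simps = lin[THEN linear_simps(1)] lin[THEN linear_simps(2)] lin[THEN linear_simps(3)]
    lin[THEN linear_simps(4)] lin[THEN linear_simps(5)]
  note comm = sch_rep_comm[OF rep, unfolded op_comm_def diff_eq_eq]
  \<comment> \<open>One rule for each pair of noncentral generators; together they bring every
    monomial into the order \<open>G\<close>, \<open>P\<close>, \<open>K\<close>, \<open>D\<close>,
    \<open>Q\<close> from left to right.\<close>
  have order:
    "P (G v) = G (P v) + scale m v"
    "K (G v) = G (K v)"
    "K (P v) = P (K v) - G v"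
    "D (G v) = G (D v) + G v"
    "D (P v) = P (D v) - P v"
    "Q (G v) = G (Q v) + P v"
    "Q (P v) = P (Q v)"
    "Q (K v) = K (Q v) + D v"
    "D (K v) = K (D v) + scale 2 (K v)"
    "Q (D v) = D (Q v) + scale 2 (Q v)" for v
    using comm[of SPx SG v] comm[of SK SG v] comm[of SK SPx v] comm[of SD SG v] comm[of SD SPx v]
      comm[of SPt SG v] comm[of SPt SPx v] comm[of SPt SK v] comm[of SD SK v] comm[of SPt SD v]
    by (simp_all add: sch_ext_simps sch_ext_axis M algebra_simps)
  \<comment> \<open>The operator names are simp-expanded to values of \<open>\<phi>\<close>, so the
    ordering rules need the same form in order to match.\<close>
  note nf = order[simplified] lin_simps
  show "sl2_relations scale L R \<rho>"
    unfolding sl2_relations_def L_def R_def \<rho>_def op_comm_def fun_eq_iff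
    by (simp add: nf normalize del: scale_scale)
  show "\<forall>A\<in>{L, R, \<rho>}. op_comm A P = (\<lambda>v. 0) \<and> op_comm A G = (\<lambda>v. 0)"
    unfolding L_def R_def \<rho>_def op_comm_def fun_eq_iff
    by (simp add: nf normalize del: scale_scale)
qed

text \<open>The quadratic terms satisfy the \<open>sl(2)\<close> relations themselves and commute
  with \<open>L\<close>, \<open>R\<close>, \<open>\<rho>\<close>, so the sums satisfy these
  relations too. Only the quadratic terms contribute to brackets with \<open>P\<close> and
  \<open>G\<close>.\<close>

lemma sch_rep_of_sl2:
  assumes lin: "\<forall>A\<in>{P, G, L, R, \<rho>}. Vector_Spaces.linear scale scale A"
    and PG: "op_comm P G = scale m"
    and sl2: "sl2_relations scale L R \<rho>"
    and comm: "\<forall>A\<in>{L, R, \<rho>}. op_comm A P = (\<lambda>v. 0) \<and> op_comm A G = (\<lambda>v. 0)"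
    and T: "T SM = scale m" "T SG = G" "T SPx = P"
      "T SK = (\<lambda>v. R v + scale c (G (G v)))"
      "T SD = (\<lambda>v. \<rho> v + scale c (G (P v)) + scale c (P (G v)))"
      "T SPt = (\<lambda>v. L v + scale c (P (P v)))"
  shows "sch_rep scale (sch_ext scale T)"
proof (rule sch_rep_sch_ext)
  have lins: "Vector_Spaces.linear scale scale P" "Vector_Spaces.linear scale scale G"
    "Vector_Spaces.linear scale scale L" "Vector_Spaces.linear scale scale R"
    "Vector_Spaces.linear scale scale \<rho>"
    using lin by auto
  note lin_simps = lins[THEN linear_simps(1)] lins[THEN linear_simps(2)]
    lins[THEN linear_simps(3)] lins[THEN linear_simps(4)] lins[THEN linear_simps(5)]
  have comms: "op_comm L G = (\<lambda>v. 0)" "op_comm R G = (\<lambda>v. 0)" "op_comm \<rho> G = (\<lambda>v. 0)"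
    "op_comm L P = (\<lambda>v. 0)" "op_comm R P = (\<lambda>v. 0)" "op_comm \<rho> P = (\<lambda>v. 0)"
    using comm by auto
  \<comment> \<open>Here the normal form is \<open>G\<close>, \<open>P\<close>, \<open>R\<close>,
    \<open>\<rho>\<close>, \<open>L\<close> from left to right.\<close>
  have order:
    "P (G v) = G (P v) + scale m v"
    "L (G v) = G (L v)" "R (G v) = G (R v)" "\<rho> (G v) = G (\<rho> v)"
    "L (P v) = P (L v)" "R (P v) = P (R v)" "\<rho> (P v) = P (\<rho> v)"
    "L (R v) = R (L v) + \<rho> v"
    "\<rho> (R v) = R (\<rho> v) + scale 2 (R v)"
    "L (\<rho> v) = \<rho> (L v) + scale 2 (L v)" for v
    using PG sl2 comms by (simp_all add: sl2_relations_def op_comm_def fun_eq_iff algebra_simps)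
  show "Vector_Spaces.linear scale scale (T b)" for b
    by (cases b) (simp_all add: T linear_iff_module_hom module_hom_iff module_axioms lin_simps
        scale_right_distrib algebra_simps)
  show "op_comm (T a) (T b) = sch_ext scale T (sch_table a b - sch_table b a)" for a b
    by (cases a; cases b; rule ext)
      (simp_all add: op_comm_def sch_ext_simps sch_ext_axis T order lin_simps normalize
        del: scale_scale)
qed

end

section \<open>Both directions with the stated coefficients\<close>

theorem theorem3p8:
  fixes smul :: "'k::field_char_0 \<Rightarrow> 'v::ab_group_add \<Rightarrow> 'v"
    and m :: 'k
  assumes "vector_space smul"
    and "m \<noteq> 0"
  shows
    "(\<forall>\<phi> M K G D P\<^sub>x P\<^sub>t.
        sch_rep smul \<phi> \<and>
        M = \<phi> (sch_e SM) \<and> K = \<phi> (sch_e SK) \<and> G = \<phi> (sch_e SG) \<and>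
        D = \<phi> (sch_e SD) \<and> P\<^sub>x = \<phi> (sch_e SPx) \<and> P\<^sub>t = \<phi> (sch_e SPt) \<and>
        M = (\<lambda>v. smul m v) \<longrightarrow>
        (\<exists>L\<^sub>0 R\<^sub>0 \<rho>\<^sub>0.
          {L\<^sub>0, R\<^sub>0, \<rho>\<^sub>0} \<subseteq> generated_algebra smul {M, K, G, D, P\<^sub>x, P\<^sub>t} \<and>
          sl2_relations smul L\<^sub>0 R\<^sub>0 \<rho>\<^sub>0 \<and>
          K = (\<lambda>v. R\<^sub>0 v + smul (1 / (2 * m)) (G (G v))) \<and>
          D = (\<lambda>v. \<rho>\<^sub>0 v + smul (1 / m) (G (P\<^sub>x v)) + smul (1 / 2) v) \<and>
          P\<^sub>t = (\<lambda>v. L\<^sub>0 v + smul (1 / (2 * m)) (P\<^sub>x (P\<^sub>x v))) \<and>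
          (\<forall>A\<in>{L\<^sub>0, R\<^sub>0, \<rho>\<^sub>0}. op_comm A P\<^sub>x = (\<lambda>v. 0) \<and> op_comm A G = (\<lambda>v. 0))))
     \<and>
     (\<forall>P\<^sub>x G L\<^sub>0 R\<^sub>0 \<rho>\<^sub>0.
        (\<forall>A\<in>{P\<^sub>x, G, L\<^sub>0, R\<^sub>0, \<rho>\<^sub>0}. Vector_Spaces.linear smul smul A) \<and>
        op_comm P\<^sub>x G = (\<lambda>v. smul m v) \<and>
        sl2_relations smul L\<^sub>0 R\<^sub>0 \<rho>\<^sub>0 \<and>
        (\<forall>A\<in>{L\<^sub>0, R\<^sub>0, \<rho>\<^sub>0}. op_comm A P\<^sub>x = (\<lambda>v. 0) \<and> op_comm A G = (\<lambda>v. 0)) \<longrightarrow>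
        (\<exists>!\<phi>. sch_rep smul \<phi> \<and>
          \<phi> (sch_e SM) = (\<lambda>v. smul m v) \<and>
          \<phi> (sch_e SG) = G \<and>
          \<phi> (sch_e SPx) = P\<^sub>x \<and>
          \<phi> (sch_e SK) = (\<lambda>v. R\<^sub>0 v + smul (1 / (2 * m)) (G (G v))) \<and>
          \<phi> (sch_e SD) = (\<lambda>v. \<rho>\<^sub>0 v + smul (1 / m) (G (P\<^sub>x v)) + smul (1 / 2) v) \<and>
          \<phi> (sch_e SPt) = (\<lambda>v. L\<^sub>0 v + smul (1 / (2 * m)) (P\<^sub>x (P\<^sub>x v)))))"
proof -
  interpret half_inverse smul "1 / (2 * m)" m
    using assms by (simp add: half_inverse_def half_inverse_axioms_def)
  have half_cm: "smul (1 / 2) v = smul (1 / (2 * m)) (smul m v)" for v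
    using \<open>m \<noteq> 0\<close> by simp
  have "1 / m = 1 / (2 * m) + 1 / (2 * m)"
    by simp
  then have inv_m: "smul (1 / m) v = smul (1 / (2 * m)) v + smul (1 / (2 * m)) v" for v
    by (metis scale_left_distrib)
  \<comment> \<open>Reordering \<open>P G\<close> as \<open>G P + m\<close> leaves the constant
    \<open>m / (2 * m)\<close>, which is the \<open>1 / 2\<close> in the formula for
    \<open>D\<close>. This links the stated form to the symmetric one.\<close>
  have symm: "smul (1 / m) (G (P v)) + smul (1 / 2) v
      = smul (1 / (2 * m)) (G (P v)) + smul (1 / (2 * m)) (P (G v))"
    if "op_comm P G = (\<lambda>v. smul m v)" for P G :: "'v \<Rightarrow> 'v" and v
    unfolding op_comm_eqD[OF that] half_cm inv_m scale_right_distrib by (simp add: add.assoc)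
  show ?thesis
  proof (intro conjI allI impI; (elim conjE)?)
    fix \<phi> and M K G D P Q :: "'v \<Rightarrow> 'v"
    assume rep: "sch_rep smul \<phi>"
      and ops: "M = \<phi> (sch_e SM)" "K = \<phi> (sch_e SK)" "G = \<phi> (sch_e SG)"
        "D = \<phi> (sch_e SD)" "P = \<phi> (sch_e SPx)" "Q = \<phi> (sch_e SPt)"
      and M: "M = (\<lambda>v. smul m v)"
    \<comment> \<open>The required formulas force all three witnesses; \<open>\<rho>\<close> is
      written symmetrically to fit \<open>sch_rep_decomposition\<close>.\<close>
    define L where "L = (\<lambda>v. Q v - smul (1 / (2 * m)) (P (P v)))"
    define R where "R = (\<lambda>v. K v - smul (1 / (2 * m)) (G (G v)))"
    define \<rho> where "\<rho> = (\<lambda>v. D v - smul (1 / (2 * m)) (G (P v)) - smul (1 / (2 * m)) (P (G v)))"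
    have PG: "op_comm P G = (\<lambda>v. smul m v)"
      using M by (auto simp: ops sch_rep_comm[OF rep] sch_ext_simps sch_ext_axis)
    \<comment> \<open>Subtraction is addition of a multiple by \<open>- a\<close>. Used once each
      for \<open>L\<close> and \<open>R\<close> and twice for \<open>\<rho>\<close>.\<close>
    have sub: "(\<lambda>v. A v - smul a (B (C v))) \<in> generated_algebra smul S"
      if "A \<in> generated_algebra smul S" "B \<in> generated_algebra smul S"
        "C \<in> generated_algebra smul S" for A B C a S
      using generated_algebra.add[OF that(1)
          generated_algebra.smul[OF generated_algebra.mult[OF that(2,3)], of "- a"]]
      by simp
    have gens: "A \<in> generated_algebra smul {M, K, G, D, P, Q}" if "A \<in> {M, K, G, D, P, Q}" for A
      using that by (rule generated_algebra.gen)
    have "{L, R, \<rho>} \<subseteq> generated_algebra smul {M, K, G, D, P, Q}"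
      unfolding L_def R_def \<rho>_def
      by (simp add: gens sub[where B = P and C = P] sub[where B = G and C = G]
          sub[where B = G and C = P] sub[where B = P and C = G])
    moreover have "sl2_relations smul L R \<rho>"
      "\<forall>A\<in>{L, R, \<rho>}. op_comm A P = (\<lambda>v. 0) \<and> op_comm A G = (\<lambda>v. 0)"
      using sch_rep_decomposition[OF rep _ ops(2-6) L_def R_def \<rho>_def] ops(1) M by simp_all
    moreover have "D = (\<lambda>v. \<rho> v + smul (1 / m) (G (P v)) + smul (1 / 2) v)"
      by (simp add: add.assoc symm[OF PG] \<rho>_def)
    ultimately show "\<exists>L\<^sub>0 R\<^sub>0 \<rho>\<^sub>0.
          {L\<^sub>0, R\<^sub>0, \<rho>\<^sub>0} \<subseteq> generated_algebra smul {M, K, G, D, P, Q} \<and>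
          sl2_relations smul L\<^sub>0 R\<^sub>0 \<rho>\<^sub>0 \<and>
          K = (\<lambda>v. R\<^sub>0 v + smul (1 / (2 * m)) (G (G v))) \<and>
          D = (\<lambda>v. \<rho>\<^sub>0 v + smul (1 / m) (G (P v)) + smul (1 / 2) v) \<and>
          Q = (\<lambda>v. L\<^sub>0 v + smul (1 / (2 * m)) (P (P v))) \<and>
          (\<forall>A\<in>{L\<^sub>0, R\<^sub>0, \<rho>\<^sub>0}. op_comm A P = (\<lambda>v. 0) \<and> op_comm A G = (\<lambda>v. 0))"
      by (intro exI[of _ L] exI[of _ R] exI[of _ \<rho>]) (simp add: L_def R_def)
  next
    fix P G L R \<rho> :: "'v \<Rightarrow> 'v"
    assume lin: "\<forall>A\<in>{P, G, L, R, \<rho>}. Vector_Spaces.linear smul smul A"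
      and PG: "op_comm P G = (\<lambda>v. smul m v)"
      and sl2: "sl2_relations smul L R \<rho>"
      and comm: "\<forall>A\<in>{L, R, \<rho>}. op_comm A P = (\<lambda>v. 0) \<and> op_comm A G = (\<lambda>v. 0)"
    \<comment> \<open>The arguments follow the constructor order \<open>SM\<close>,
      \<open>SK\<close>, \<open>SG\<close>, \<open>SD\<close>, \<open>SPx\<close>,
      \<open>SPt\<close>.\<close>
    define T where "T = case_sch_basis (\<lambda>v. smul m v) (\<lambda>v. R v + smul (1 / (2 * m)) (G (G v))) G
      (\<lambda>v. \<rho> v + smul (1 / m) (G (P v)) + smul (1 / 2) v) P
      (\<lambda>v. L v + smul (1 / (2 * m)) (P (P v)))"
    have "T SD = (\<lambda>v. \<rho> v + smul (1 / (2 * m)) (G (P v)) + smul (1 / (2 * m)) (P (G v)))"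
      unfolding T_def by (simp add: add.assoc symm[OF PG])
    then have rep: "sch_rep smul (sch_ext smul T)"
      using sch_rep_of_sl2[OF lin PG sl2 comm, of T] by (simp add: T_def)
    show "\<exists>!\<phi>. sch_rep smul \<phi> \<and>
          \<phi> (sch_e SM) = (\<lambda>v. smul m v) \<and>
          \<phi> (sch_e SG) = G \<and>
          \<phi> (sch_e SPx) = P \<and>
          \<phi> (sch_e SK) = (\<lambda>v. R v + smul (1 / (2 * m)) (G (G v))) \<and>
          \<phi> (sch_e SD) = (\<lambda>v. \<rho> v + smul (1 / m) (G (P v)) + smul (1 / 2) v) \<and>
          \<phi> (sch_e SPt) = (\<lambda>v. L v + smul (1 / (2 * m)) (P (P v)))"
    proof (rule ex1I[of _ "sch_ext smul T"], goal_cases)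
      case 1
      show ?case by (simp add: rep sch_ext_axis) (simp add: T_def)
    next
      \<comment> \<open>Uniqueness: the six prescribed values are those of \<open>T\<close>, and
        they determine \<open>\<phi>\<close> by linearity.\<close>
      case (2 \<phi>)
      then have "\<phi> (sch_e b) = T b" for b
        by (cases b) (simp_all add: T_def)
      then show ?case
        using sch_rep_eq_sch_ext[of \<phi>] 2 by simp
    qed
  qed
qed

end
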